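(* Let $q>8/15$. The inequality $$SB(b,a)>\left(\frac{8}{15q}a^q+\left(1-\frac{8}{15q}\right)b^q\right)^{5/(15q-8)}a^{(10q-8)/(15q-8)}$$ holds for all $b>a>0$ if and only if $q\ge34/35$. The reverse inequality (with $<$ in place of $>$) holds for all $b>a>0$ if and only if $q\le4/5$.
   Context: For $b>a>0$, $SB(b,a)=\dfrac{\sqrt{b^2-a^2}}{\operatorname{arccosh}(b/a)}$ is the Schwab–Borchardt mean. *)

theory Defs
  imports Complex_Main
begin

text \<open>
  The Schwab--Borchardt mean, with the larger argument first. The formula is
  meaningful for \<open>b > a > 0\<close> only; no convention is intended elsewhere.
\<close>

definition SB :: "real \<Rightarrow> real \<Rightarrow> real" where
  "SB b a = sqrt (b\<^sup>2 - a\<^sup>2) / arcosh (b / a)"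

end

theory Submission
  imports Defs "HOL-Real_Asymp.Real_Asymp" "HOL-Analysis.Convex"
begin

text \<open>
  Substitute \<open>b = a cosh t\<close>. Both sides are homogeneous of degree one, and the logarithm of their
  quotient is \<open>gap q t\<close>, which vanishes as \<open>t\<close> tends to \<open>0\<close>. Its derivative is positive exactly when
  \<open>weight q t > threshold t\<close>, and \<open>weight q t\<close> increases with \<open>q\<close>, so sufficiency has to be shown for
  \<open>q = 34/35\<close> and \<open>q = 4/5\<close> only. In these two cases the comparison of \<open>weight\<close> with \<open>threshold\<close> says
  that a quotient of elementary functions stays on one side of its limit at \<open>0\<close>; the derivative of this quotient
  has the sign of a function whose power series has coefficients of constant sign.
  Necessity of \<open>q \<ge> 34/35\<close> follows from the expansion of \<open>weight - threshold\<close> at \<open>0\<close>, and necessity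
  of \<open>q \<le> 4/5\<close> from the growth of \<open>gap\<close> at infinity.
\<close>

section \<open>Strict bounds from a limit at 0 and the sign of the derivative\<close>

lemma greater_limit_if_deriv_pos:
  fixes f :: "real \<Rightarrow> real"
  assumes lim: "(f \<longlongrightarrow> L) (at_right 0)"
    and deriv: "\<And>s. 0 < s \<Longrightarrow> s \<le> t \<Longrightarrow> \<exists>d > 0. (f has_real_derivative d) (at s)"
    and t: "0 < t"
  shows "f t > L"
proof -
  have less: "f x < f y" if "0 < x" "x < y" "y \<le> t" for x y
  proof (rule DERIV_pos_imp_increasing[OF \<open>x < y\<close>])
    fix s assume "x \<le> s" "s \<le> y"
    then show "\<exists>d. (f has_real_derivative d) (at s) \<and> 0 < d"
      using deriv[of s] that by auto
  qed
  \<comment> \<open>Passing to the limit only yields a weak inequality. Comparing with the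
    intermediate point \<open>t/2\<close> first leaves room for the strict step from
    \<open>t/2\<close> to \<open>t\<close>.\<close>
  have "eventually (\<lambda>x. f x \<le> f (t/2)) (at_right 0)"
    unfolding eventually_at_right_field
    by (rule exI[of _ "t/2"]) (use less t in \<open>fastforce intro: less_imp_le\<close>)
  then have "L \<le> f (t/2)"
    by (intro tendsto_upperbound[OF lim]) auto
  also have "f (t/2) < f t"
    using less t by simp
  finally show ?thesis .
qed

lemma less_limit_if_deriv_neg:
  fixes f :: "real \<Rightarrow> real"
  assumes lim: "(f \<longlongrightarrow> L) (at_right 0)"
    and deriv: "\<And>s. 0 < s \<Longrightarrow> s \<le> t \<Longrightarrow> \<exists>d < 0. (f has_real_derivative d) (at s)"
    and t: "0 < t"
  shows "f t < L"
proof -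
  have "- f t > - L"
  proof (rule greater_limit_if_deriv_pos[where f = "\<lambda>x. - f x"])
    show "((\<lambda>x. - f x) \<longlongrightarrow> - L) (at_right 0)"
      by (intro tendsto_minus lim)
    fix s assume "0 < s" "s \<le> t"
    then obtain d where "d < 0" "(f has_real_derivative d) (at s)"
      using deriv by blast
    then show "\<exists>d > 0. ((\<lambda>x. - f x) has_real_derivative d) (at s)"
      by (intro exI[of _ "-d"]) (auto intro: derivative_eq_intros)
  qed (use t in simp)
  then show ?thesis by simp
qed

section \<open>Power series\<close>

text \<open>Multiplication by \<open>t\<close> shifts the series by one index, which turns 1/(n-1)!
  into n/n!. All series here are brought to the common shape of a coefficient times
  \<open>t ^ n / fact n\<close>, so that they can be added termwise. Writing
  \<open>c ^ n / c\<close> avoids the exponent n-1 at n = 0, where the factor \<open>n\<close> kills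
  the term.\<close>

lemma sums_times_sinh:
  fixes c t :: real
  assumes "c \<noteq> 0"
  shows "(\<lambda>n. if even n then real n * c ^ n / c * t ^ n / fact n else 0) sums (t * sinh (c * t))"
proof (rule sums_Suc_imp)
  have eq: "(\<lambda>n. t * (if even n then 0 else (c * t) ^ n /\<^sub>R fact n)) =
     (\<lambda>n. if even (Suc n) then Suc n * c ^ Suc n / c * t ^ Suc n / fact (Suc n) else 0)"
    using assms by (auto simp: fun_eq_iff power_mult_distrib field_simps simp del: of_nat_Suc)
  show "(\<lambda>n. if even (Suc n) then Suc n * c ^ Suc n / c * t ^ Suc n / fact (Suc n) else 0)
     sums (t * sinh (c * t))"
    using sums_mult[OF sinh_converges[of "c * t"], of t] unfolding eq .
qed simp

lemma sums_times_cosh: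
  fixes c t :: real
  assumes "c \<noteq> 0"
  shows "(\<lambda>n. if even n then 0 else real n * c ^ n / c * t ^ n / fact n) sums (t * cosh (c * t))"
proof (rule sums_Suc_imp)
  have eq: "(\<lambda>n. t * (if even n then (c * t) ^ n /\<^sub>R fact n else 0)) =
     (\<lambda>n. if even (Suc n) then 0 else Suc n * c ^ Suc n / c * t ^ Suc n / fact (Suc n))"
    using assms by (auto simp: fun_eq_iff power_mult_distrib field_simps simp del: of_nat_Suc)
  show "(\<lambda>n. if even (Suc n) then 0 else Suc n * c ^ Suc n / c * t ^ Suc n / fact (Suc n))
     sums (t * cosh (c * t))"
    using sums_mult[OF cosh_converges[of "c * t"], of t] unfolding eq .
qed simp

lemma sums_square_times_cosh:
  fixes c t :: real
  assumes "c \<noteq> 0"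
  shows "(\<lambda>n. if even n then real n * (real n - 1) * c ^ n / c\<^sup>2 * t ^ n / fact n else 0)
     sums (t\<^sup>2 * cosh (c * t))"
proof (rule sums_Suc_imp)
  have eq: "(\<lambda>n. t * (if even n then 0 else real n * c ^ n / c * t ^ n / fact n)) =
     (\<lambda>n. if even (Suc n)
       then real (Suc n) * (real (Suc n) - 1) * c ^ Suc n / c\<^sup>2 * t ^ Suc n / fact (Suc n) else 0)"
    using assms by (auto simp: fun_eq_iff power2_eq_square fact_Suc simp del: of_nat_Suc)
  show "(\<lambda>n. if even (Suc n)
       then real (Suc n) * (real (Suc n) - 1) * c ^ Suc n / c\<^sup>2 * t ^ Suc n / fact (Suc n) else 0)
     sums (t\<^sup>2 * cosh (c * t))"
    using sums_mult[OF sums_times_cosh[OF assms, of t], of t] unfolding eq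
    by (simp add: power2_eq_square mult.assoc)
qed simp

lemma sums_cosh:
  fixes c t :: real
  shows "(\<lambda>n. if even n then c ^ n * t ^ n / fact n else 0) sums cosh (c * t)"
proof -
  have "(\<lambda>n. if even n then (c * t) ^ n /\<^sub>R fact n else 0) =
      (\<lambda>n. if even n then c ^ n * t ^ n / fact n else 0)"
    by (auto simp: fun_eq_iff power_mult_distrib field_simps)
  then show ?thesis
    using cosh_converges[of "c * t"] by simp
qed

lemma sums_pos:
  fixes f :: "nat \<Rightarrow> real"
  assumes "f sums s" "\<And>n. 0 \<le> f n" "0 < f k"
  shows "0 < s"
  using suminf_pos2[of f k] assms by (auto simp: sums_iff)

section \<open>Signs of the two numerators by triple-angle formulas and power series\<close>

lemma sinh_triple: "sinh (3 * t :: real) = sinh t * (4 * (cosh t)\<^sup>2 - 1)"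
proof -
  have "sinh (3 * t) = sinh (2 * t + t)" by simp
  also have "\<dots> = sinh t * (4 * (cosh t)\<^sup>2 - 1)"
    unfolding sinh_add sinh_double cosh_double using cosh_square_eq[of t] by algebra
  finally show ?thesis .
qed

lemma cosh_triple: "cosh (3 * t :: real) = cosh t * (4 * (sinh t)\<^sup>2 + 1)"
proof -
  have "cosh (3 * t) = cosh (2 * t + t)" by simp
  also have "\<dots> = cosh t * (4 * (sinh t)\<^sup>2 + 1)"
    unfolding cosh_add sinh_double cosh_double using cosh_square_eq[of t] by algebra
  finally show ?thesis .
qed

text \<open>The triple-angle formulas linearize the products: the expression equals t sinh 3t -
  (9/4)(cosh 3t - cosh t) + 6 t^2 cosh t, an even power series with coefficients
  \<open>a n / fact n\<close>.\<close>

lemma numerator_4_5_pos: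
  fixes t :: real
  assumes "t > 0"
  shows "t * sinh t * (4 * (cosh t)\<^sup>2 - 1) - 9 * (sinh t)\<^sup>2 * cosh t + 6 * t\<^sup>2 * cosh t > 0"
proof -
  define a :: "nat \<Rightarrow> real"
    where "a n = 3 ^ n * (n / 3 - 9 / 4) + 9 / 4 + 6 * n * (real n - 1)" for n
  have "(\<lambda>n. (if even n then real n * 3 ^ n / 3 * t ^ n / fact n else 0)
      - 9/4 * (if even n then 3 ^ n * t ^ n / fact n else 0)
      + 9/4 * (if even n then 1 ^ n * t ^ n / fact n else 0)
      + 6 * (if even n then real n * (real n - 1) * 1 ^ n / 1\<^sup>2 * t ^ n / fact n else 0))
    sums (t * sinh (3 * t) - 9/4 * cosh (3 * t) + 9/4 * cosh (1 * t) + 6 * (t\<^sup>2 * cosh (1 * t)))"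
    by (intro sums_add sums_diff sums_mult sums_times_sinh sums_cosh sums_square_times_cosh) auto
  also have "(\<lambda>n. (if even n then real n * 3 ^ n / 3 * t ^ n / fact n else 0)
      - 9/4 * (if even n then 3 ^ n * t ^ n / fact n else 0)
      + 9/4 * (if even n then 1 ^ n * t ^ n / fact n else 0)
      + 6 * (if even n then real n * (real n - 1) * 1 ^ n / 1\<^sup>2 * t ^ n / fact n else 0)) =
      (\<lambda>n. if even n then a n * t ^ n / fact n else 0)"
    by (auto simp: fun_eq_iff a_def field_simps)
  finally have sums: "(\<lambda>n. if even n then a n * t ^ n / fact n else 0) sums
      (t * sinh (3 * t) - 9/4 * cosh (3 * t) + 9/4 * cosh (1 * t) + 6 * (t\<^sup>2 * cosh (1 * t)))" .
  have large: "a n > 0" if "n \<ge> 8" for n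
  proof -
    have "3 ^ n * (n / 3 - 9 / 4) \<ge> (0::real)" "6 * real n * (real n - 1) \<ge> 0"
      using that by simp_all
    then show ?thesis by (simp add: a_def)
  qed
  \<comment> \<open>The even coefficients up to n = 6 are all zero; n = 8 gives the first positive
    one.\<close>
  have nonneg: "a n \<ge> 0" if "even n" for n
  proof (cases "n \<ge> 8")
    case False
    then have "n = 0 \<or> n = 2 \<or> n = 4 \<or> n = 6"
      using that by presburger
    then show ?thesis by (auto simp: a_def)
  qed (use large in \<open>auto intro: less_imp_le\<close>)
  have "0 < t * sinh (3 * t) - 9/4 * cosh (3 * t) + 9/4 * cosh (1 * t) + 6 * (t\<^sup>2 * cosh (1 * t))"
    by (rule sums_pos[OF sums, where k = 8]) (use nonneg large[of 8] assms in auto)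
  then show ?thesis
    unfolding sinh_triple cosh_triple by (simp add: algebra_simps)
qed

lemma square_less_power3: "n \<ge> 10 \<Longrightarrow> 27 * (real n)\<^sup>2 + 21 < 3 ^ n"
proof (induction n rule: nat_induct_at_least)
  case (Suc n)
  have "3 * real n \<le> (real n)\<^sup>2"
    using Suc.hyps by (simp add: power2_eq_square)
  moreover have "1 \<le> real n" using Suc.hyps by simp
  ultimately have "27 * (real (Suc n))\<^sup>2 + 21 \<le> 3 * (27 * (real n)\<^sup>2 + 21)"
    unfolding of_nat_Suc power2_eq_square distrib_left distrib_right by linarith
  also have "\<dots> < 3 * 3 ^ n" using Suc.IH by simp
  finally show ?case by simp
qed simp

text \<open>Linearized by the triple-angle formulas, the negative of the expression is
  \<open>?s\<close>, whose even power series has nonnegative coefficients. Those up to n = 8 vanish;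
  from n = 10 on the term with \<open>3 ^ n\<close> dominates.\<close>

lemma numerator_34_35_neg:
  fixes t :: real
  assumes "t > 0"
  shows "58 * t * sinh t * (cosh t)\<^sup>2 - 81 * (sinh t)\<^sup>2 * cosh t - 12 * t\<^sup>2 * (cosh t) ^ 3
    + 36 * t\<^sup>2 * cosh t - t * sinh t < 0"
proof -
  define a :: "nat \<Rightarrow> real"
    where "a n = 3 ^ n * (n * (real n - 1) / 3 + 81 / 4 - 29 / 6 * n)
      - 27 * n * (real n - 1) - 27 / 2 * n - 81 / 4" for n
  let ?s = "- (29/2 * (t * sinh (3 * t))) + 81/4 * cosh (3 * t) + 3 * (t\<^sup>2 * cosh (3 * t))
    - 27/2 * (t * sinh (1 * t)) - 81/4 * cosh (1 * t) - 27 * (t\<^sup>2 * cosh (1 * t))"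
  have "(\<lambda>n. - (29/2 * (if even n then real n * 3 ^ n / 3 * t ^ n / fact n else 0))
      + 81/4 * (if even n then 3 ^ n * t ^ n / fact n else 0)
      + 3 * (if even n then real n * (real n - 1) * 3 ^ n / 3\<^sup>2 * t ^ n / fact n else 0)
      - 27/2 * (if even n then real n * 1 ^ n / 1 * t ^ n / fact n else 0)
      - 81/4 * (if even n then 1 ^ n * t ^ n / fact n else 0)
      - 27 * (if even n then real n * (real n - 1) * 1 ^ n / 1\<^sup>2 * t ^ n / fact n else 0))
    sums ?s"
    by (intro sums_add sums_diff sums_minus sums_mult sums_times_sinh sums_cosh sums_square_times_cosh) auto
  also have "(\<lambda>n. - (29/2 * (if even n then real n * 3 ^ n / 3 * t ^ n / fact n else 0))
      + 81/4 * (if even n then 3 ^ n * t ^ n / fact n else 0)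
      + 3 * (if even n then real n * (real n - 1) * 3 ^ n / 3\<^sup>2 * t ^ n / fact n else 0)
      - 27/2 * (if even n then real n * 1 ^ n / 1 * t ^ n / fact n else 0)
      - 81/4 * (if even n then 1 ^ n * t ^ n / fact n else 0)
      - 27 * (if even n then real n * (real n - 1) * 1 ^ n / 1\<^sup>2 * t ^ n / fact n else 0)) =
      (\<lambda>n. if even n then a n * t ^ n / fact n else 0)"
    by (auto simp: fun_eq_iff a_def field_simps)
  finally have sums: "(\<lambda>n. if even n then a n * t ^ n / fact n else 0) sums ?s" .
  have large: "a n > 0" if "n \<ge> 10" for n
  proof -
    \<comment> \<open>The factor of \<open>3 ^ n\<close> in \<open>a n\<close> minus 1 equals
      (2(n-10)(2n-11) + 11)/12, so it is nonnegative for n at least 10.\<close>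
    have "0 \<le> (real n - 10) * (2 * real n - 11)"
      using that by simp
    then have "n * (real n - 1) / 3 + 81 / 4 - 29 / 6 * n \<ge> 1"
      by (simp add: algebra_simps diff_divide_distrib)
    then have "3 ^ n * 1 \<le> 3 ^ n * (n * (real n - 1) / 3 + 81 / 4 - 29 / 6 * n)"
      by (intro mult_left_mono) auto
    moreover have "27 * real n * (real n - 1) + 27 / 2 * n + 81 / 4 < 27 * (real n)\<^sup>2 + 21"
      by (simp add: power2_eq_square algebra_simps)
    ultimately show ?thesis
      using square_less_power3[OF that] unfolding a_def by linarith
  qed
  have nonneg: "a n \<ge> 0" if "even n" for n
  proof (cases "n \<ge> 10")
    case False
    then have "n = 0 \<or> n = 2 \<or> n = 4 \<or> n = 6 \<or> n = 8"
      using that by presburger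
    then show ?thesis by (auto simp: a_def)
  qed (use large in \<open>auto intro: less_imp_le\<close>)
  have "0 < ?s"
    by (rule sums_pos[OF sums, where k = 10]) (use nonneg large[of 10] assms in auto)
  then show ?thesis
    unfolding sinh_triple cosh_triple sinh_square_eq
    by (simp add: algebra_simps power2_eq_square power3_eq_cube)
qed

section \<open>Comparison of \<open>weight\<close> and \<open>threshold\<close>\<close>

lemma sinh_less_times_cosh: "sinh t < t * cosh t" if "t > 0" for t :: real
proof -
  have "t * cosh t - sinh t > 0"
  proof (rule greater_limit_if_deriv_pos[where f = "\<lambda>t. t * cosh t - sinh t"])
    show "((\<lambda>t::real. t * cosh t - sinh t) \<longlongrightarrow> 0) (at_right 0)"
      unfolding sinh_field_def cosh_field_def by real_asymp
    fix s :: real assume "0 < s"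
    then show "\<exists>d > 0. ((\<lambda>t. t * cosh t - sinh t) has_real_derivative d) (at s)"
      by (intro exI[of _ "s * sinh s"]) (auto intro!: derivative_eq_intros)
  qed (use that in simp)
  then show ?thesis by simp
qed

text \<open>This is the weighted mean of 1 and \<open>cosh t powr q\<close>, with weight 8/(15q) on
  1, divided by \<open>cosh t powr q\<close>.\<close>

definition weight :: "real \<Rightarrow> real \<Rightarrow> real" where
  "weight q t = 1 - 8 / (15 * q) * (1 - cosh t powr (- q))"

text \<open>The value of \<open>weight q t\<close> at which the derivative of \<open>gap q\<close>
  at \<open>t\<close> would vanish; it does not depend on \<open>q\<close>.\<close>

definition threshold :: "real \<Rightarrow> real" where
  "threshold t = t * (sinh t)\<^sup>2 / (3 * cosh t * (t * cosh t - sinh t))"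

lemma weight_mono:
  assumes "0 < p" "p \<le> q"
  shows "weight p t \<le> weight q t"
proof -
  define x where "x = ln (cosh t)"
  \<comment> \<open>With x = ln cosh t, the point -px is a convex combination of 0 and -qx.
    Convexity of exp thus makes (1 - exp(-qx))/q decreasing in q.\<close>
  have "exp ((1 - p / q) *\<^sub>R 0 + (p / q) *\<^sub>R (- q * x)) \<le> (1 - p / q) * exp 0 + (p / q) * exp (- q * x)"
    by (rule convex_onD[OF exp_convex]) (use assms in auto)
  then have "exp (- p * x) \<le> 1 - p / q + p / q * exp (- q * x)"
    using assms by simp
  then have "(1 - exp (- q * x)) / q \<le> (1 - exp (- p * x)) / p"
    using assms mult_strict_left_mono[of _ _ q] by (simp add: divide_simps) (simp add: algebra_simps)
  then have "8 / 15 * ((1 - exp (- q * x)) / q) \<le> 8 / 15 * ((1 - exp (- p * x)) / p)"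
    by (rule mult_left_mono) simp
  moreover have "cosh t powr a = exp (a * x)" for a
    using cosh_real_pos[of t] by (simp add: powr_def x_def)
  ultimately show ?thesis
    by (simp add: weight_def)
qed

lemma weight_pos:
  assumes "q > 8 / 15"
  shows "weight q t > 0"
proof -
  have "8 / (15 * q) * (1 - cosh t powr (- q)) < 8 / (15 * q) * 1"
    using assms cosh_real_pos[of t] by (intro mult_strict_left_mono) auto
  also have "\<dots> < 1"
    using assms by simp
  finally have "8 / (15 * q) * (1 - cosh t powr (- q)) < 1" .
  then show ?thesis by (simp add: weight_def)
qed

text \<open>For q = 34/35 the weight is (23 + 28 cosh^(-34/35) t)/51. Multiplying the claim by 51
  cosh t \<open>D t\<close> and moving the term with 23 across turns it into \<open>M t\<close> /
  (cosh^(1/35) t \<open>D t\<close>) < 28, and 28 is the limit of this quotient at 0.\<close>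

lemma threshold_less_weight:
  assumes "t > 0"
  shows "threshold t < weight (34 / 35) t"
proof -
  define M :: "real \<Rightarrow> real" where "M s = 23 * sinh s * cosh s - 6 * s * (cosh s)\<^sup>2 - 17 * s" for s
  define D :: "real \<Rightarrow> real" where "D s = s * cosh s - sinh s" for s
  have D_pos: "D s > 0" if "s > 0" for s
    using sinh_less_times_cosh[OF that] by (simp add: D_def)
  let ?c = "\<lambda>s::real. cosh s powr (1 / 35)"
  have "M t / (?c t * D t) < 28"
  proof (rule less_limit_if_deriv_neg[where f = "\<lambda>t. M t / (?c t * D t)"])
    show "((\<lambda>t. M t / (?c t * D t)) \<longlongrightarrow> 28) (at_right 0)"
      unfolding M_def D_def sinh_field_def cosh_field_def by real_asymp
    fix s :: real assume s: "0 < s"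
    define P where "P = 58 * s * sinh s * (cosh s)\<^sup>2 - 81 * (sinh s)\<^sup>2 * cosh s - 12 * s\<^sup>2 * (cosh s) ^ 3
      + 36 * s\<^sup>2 * cosh s - s * sinh s"
    have M': "(M has_real_derivative 4 * sinh s * (10 * sinh s - 3 * s * cosh s)) (at s)"
      unfolding M_def
      by (auto intro!: derivative_eq_intros)
        (use cosh_square_eq[of s] in \<open>simp add: algebra_simps power2_eq_square\<close>)
    have D': "(D has_real_derivative s * sinh s) (at s)"
      unfolding D_def by (auto intro!: derivative_eq_intros)
    have c': "(?c has_real_derivative ?c s * sinh s / (35 * cosh s)) (at s)"
      using powr_diff[of "cosh s" "1 / 35" 1] by (auto intro!: derivative_eq_intros)
    have c_pos: "?c s > 0" by simp
    let ?d = "(4 * sinh s * (10 * sinh s - 3 * s * cosh s) * (?c s * D s)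
        - M s * (?c s * sinh s / (35 * cosh s) * D s + s * sinh s * ?c s)) / (?c s * D s * (?c s * D s))"
    have deriv: "((\<lambda>t. M t / (?c t * D t)) has_real_derivative ?d) (at s)"
      by (rule DERIV_divide[OF M' DERIV_mult[OF c' D']]) (use D_pos[OF s] in simp)
    have num: "4 * sinh s * (10 * sinh s - 3 * s * cosh s) * (?c s * D s)
        - M s * (?c s * sinh s / (35 * cosh s) * D s + s * sinh s * ?c s)
        = ?c s * sinh s * (17 * P) / (35 * cosh s)"
    proof -
      \<comment> \<open>After the common factor of the quotient rule's numerator is removed, a
        polynomial identity in s, sinh s and cosh s modulo cosh^2 = 1 + sinh^2 remains.\<close>
      have eq: "35 * cosh s * (4 * (10 * sinh s - 3 * s * cosh s) * D s) - M s * (D s + 35 * cosh s * s)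
        = 17 * P"
        unfolding P_def M_def D_def using cosh_square_eq[of s] by algebra
      show ?thesis
        unfolding eq[symmetric] using cosh_real_pos[of s] by (simp add: field_simps)
    qed
    have "?c s * sinh s * (17 * P) / (35 * cosh s) < 0"
      using numerator_34_35_neg[OF s] s cosh_real_pos[of s]
      by (simp add: P_def divide_neg_pos mult_pos_neg)
    then have "?d < 0"
      unfolding num by (rule divide_neg_pos) (use c_pos D_pos[OF s] in simp)
    then show "\<exists>d < 0. ((\<lambda>t. M t / (?c t * D t)) has_real_derivative d) (at s)"
      using deriv by blast
  qed (use assms in simp)
  then have "M t < 28 * ?c t * D t"
    using D_pos[OF assms] by (simp add: field_simps)
  moreover have pw: "cosh t powr (- (34 / 35)) = ?c t / cosh t"
    using powr_diff[of "cosh t" "1 / 35" 1] by simp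
  moreover have "17 * t * (sinh t)\<^sup>2 = M t + 23 * cosh t * D t"
    unfolding M_def D_def sinh_square_eq by (simp add: algebra_simps power2_eq_square)
  ultimately show ?thesis
    using D_pos[OF assms] cosh_real_pos[of t]
    unfolding threshold_def weight_def D_def[symmetric] pw
    by (simp add: field_simps)
qed

text \<open>For q = 4/5 the weight is (1 + 2 cosh^(-4/5) t)/3. Multiplied by 3 cosh t
  \<open>D t\<close>, the claim becomes \<open>M t\<close> / (cosh^(1/5) t \<open>D t\<close>) > 2,
  where 2 is the limit at 0.\<close>

lemma weight_less_threshold:
  assumes "t > 0"
  shows "weight (4 / 5) t < threshold t"
proof -
  define M :: "real \<Rightarrow> real" where "M s = sinh s * cosh s - s" for s
  define D :: "real \<Rightarrow> real" where "D s = s * cosh s - sinh s" for s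
  have D_pos: "D s > 0" if "s > 0" for s
    using sinh_less_times_cosh[OF that] by (simp add: D_def)
  let ?c = "\<lambda>s::real. cosh s powr (1 / 5)"
  have "M t / (?c t * D t) > 2"
  proof (rule greater_limit_if_deriv_pos[where f = "\<lambda>t. M t / (?c t * D t)"])
    show "((\<lambda>t. M t / (?c t * D t)) \<longlongrightarrow> 2) (at_right 0)"
      unfolding M_def D_def sinh_field_def cosh_field_def by real_asymp
    fix s :: real assume s: "0 < s"
    define P where "P = s * sinh s * (4 * (cosh s)\<^sup>2 - 1) - 9 * (sinh s)\<^sup>2 * cosh s + 6 * s\<^sup>2 * cosh s"
    have M': "(M has_real_derivative 2 * (sinh s)\<^sup>2) (at s)"
      unfolding M_def
      by (auto intro!: derivative_eq_intros)
        (use cosh_square_eq[of s] in \<open>simp add: algebra_simps power2_eq_square\<close>)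
    have D': "(D has_real_derivative s * sinh s) (at s)"
      unfolding D_def by (auto intro!: derivative_eq_intros)
    have c': "(?c has_real_derivative ?c s * sinh s / (5 * cosh s)) (at s)"
      using powr_diff[of "cosh s" "1 / 5" 1] by (auto intro!: derivative_eq_intros)
    have c_pos: "?c s > 0" by simp
    let ?d = "(2 * (sinh s)\<^sup>2 * (?c s * D s)
        - M s * (?c s * sinh s / (5 * cosh s) * D s + s * sinh s * ?c s)) / (?c s * D s * (?c s * D s))"
    have deriv: "((\<lambda>t. M t / (?c t * D t)) has_real_derivative ?d) (at s)"
      by (rule DERIV_divide[OF M' DERIV_mult[OF c' D']]) (use D_pos[OF s] in simp)
    have num: "2 * (sinh s)\<^sup>2 * (?c s * D s)
        - M s * (?c s * sinh s / (5 * cosh s) * D s + s * sinh s * ?c s)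
        = ?c s * sinh s * P / (5 * cosh s)"
    proof -
      have eq: "5 * cosh s * (2 * sinh s * D s) - M s * (D s + 5 * cosh s * s) = P"
        unfolding P_def M_def D_def using cosh_square_eq[of s] by algebra
      show ?thesis
        unfolding eq[symmetric] using cosh_real_pos[of s]
        by (simp add: field_simps power2_eq_square)
    qed
    have "?c s * sinh s * P / (5 * cosh s) > 0"
      using numerator_4_5_pos[OF s] s cosh_real_pos[of s]
      by (simp add: P_def)
    then have "?d > 0"
      unfolding num by (rule divide_pos_pos) (use c_pos D_pos[OF s] in simp)
    then show "\<exists>d > 0. ((\<lambda>t. M t / (?c t * D t)) has_real_derivative d) (at s)"
      using deriv by blast
  qed (use assms in simp)
  then have "M t > 2 * ?c t * D t"
    using D_pos[OF assms] by (simp add: field_simps)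
  moreover have pw: "cosh t powr (- (4 / 5)) = ?c t / cosh t"
    using powr_diff[of "cosh t" "1 / 5" 1] by simp
  moreover have "t * (sinh t)\<^sup>2 = M t + cosh t * D t"
    unfolding M_def D_def sinh_square_eq by (simp add: algebra_simps power2_eq_square)
  ultimately show ?thesis
    using D_pos[OF assms] cosh_real_pos[of t]
    unfolding threshold_def weight_def D_def[symmetric] pw
    by (simp add: field_simps)
qed

section \<open>Expansion at 0\<close>

text \<open>With L = ln cosh t, both functions are 1 - (8/15) L up to order t^4, so the lower orders
  cancel. At order t^4 the weight adds (4/15) q L^2, that is q/15, and the threshold adds
  34/525.\<close>

lemma weight_minus_threshold_asymp:
  assumes "q > 0"
  shows "((\<lambda>t. (weight q t - threshold t) / t ^ 4) \<longlongrightarrow> (q - 34 / 35) / 15) (at_right 0)"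
proof -
  have "((\<lambda>x::real. ((1 - exp (- q * x)) / q - x) / x\<^sup>2) \<longlongrightarrow> - q / 2) (at_right 0)"
    using assms by real_asymp
  moreover have "filterlim (\<lambda>t::real. ln (cosh t)) (at_right 0) (at_right 0)"
    unfolding cosh_field_def by real_asymp
  ultimately have "((\<lambda>t::real. ((1 - exp (- q * ln (cosh t))) / q - ln (cosh t)) / (ln (cosh t))\<^sup>2)
      \<longlongrightarrow> - q / 2) (at_right 0)"
    by (rule filterlim_compose)
  moreover have "((\<lambda>t::real. (ln (cosh t))\<^sup>2 / t ^ 4) \<longlongrightarrow> 1 / 4) (at_right 0)"
    unfolding cosh_field_def by (real_asymp simp: power2_eq_square)
  moreover have "((\<lambda>t. (threshold t - 1 + 8 / 15 * ln (cosh t)) / t ^ 4) \<longlongrightarrow> 34 / 525) (at_right 0)"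
    unfolding threshold_def sinh_field_def cosh_field_def by real_asymp
  ultimately have "((\<lambda>t. - (8 / 15) * (((1 - exp (- q * ln (cosh t))) / q - ln (cosh t)) / (ln (cosh t))\<^sup>2
        * ((ln (cosh t))\<^sup>2 / t ^ 4)) - (threshold t - 1 + 8 / 15 * ln (cosh t)) / t ^ 4)
      \<longlongrightarrow> - (8 / 15) * (- q / 2 * (1 / 4)) - 34 / 525) (at_right 0)" (is "(?f \<longlongrightarrow> _) _")
    by (intro tendsto_diff tendsto_mult tendsto_const)
  moreover have "- (8 / 15) * (- q / 2 * (1 / 4)) - 34 / 525 = (q - 34 / 35) / 15"
    by simp
  ultimately have lim: "(?f \<longlongrightarrow> (q - 34 / 35) / 15) (at_right 0)"
    by (simp only:)
  have "eventually (\<lambda>t. ?f t = (weight q t - threshold t) / t ^ 4) (at_right 0)"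
    using eventually_at_right_less[of "0::real"]
  proof eventually_elim
    case (elim t)
    define E where "E = exp (- q * ln (cosh t))"
    have nz: "ln (cosh t) \<noteq> 0"
      using cosh_real_strict_mono[of 0 t] elim by simp
    \<comment> \<open>The factor L^2 was inserted only to split the limit into simpler ones; it
      cancels because L is nonzero for t > 0.\<close>
    have "- (8 / 15) * ((B - L) / L\<^sup>2 * (L\<^sup>2 / u)) - (T - 1 + 8 / 15 * L) / u = (1 - 8 / 15 * B - T) / u"
      if "L \<noteq> 0" for B L T u :: real
    proof -
      have "(B - L) / L\<^sup>2 * (L\<^sup>2 / u) = (B - L) / u"
        using that by simp
      then show ?thesis
        by (simp only:) (simp add: algebra_simps add_divide_distrib diff_divide_distrib)
    qed
    note this[OF nz, of "(1 - E) / q" "t ^ 4" "threshold t"]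
    also have "8 / 15 * ((1 - E) / q) = 8 / (15 * q) * (1 - E)"
      by simp
    also have "E = cosh t powr (- q)"
      using cosh_real_pos[of t] by (simp add: E_def powr_def)
    finally show ?case
      unfolding weight_def powr_def by simp
  qed
  then show ?thesis
    by (rule Lim_transform_eventually[OF lim])
qed

section \<open>The logarithmic gap\<close>

text \<open>After the substitution b = a cosh t both sides of the inequality are a times a function
  of t. The first logarithm belongs to the Schwab-Borchardt mean, the second to the bound.\<close>

definition gap :: "real \<Rightarrow> real \<Rightarrow> real" where
  "gap q t = ln (sinh t / t)
     - 5 / (15 * q - 8) * ln (8 / (15 * q) + (1 - 8 / (15 * q)) * cosh t powr q)"

lemma weighted_mean_pos:
  assumes "q > 8 / 15"
  shows "8 / (15 * q) + (1 - 8 / (15 * q)) * cosh (t::real) powr q > 0"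
  using assms by (intro add_pos_nonneg mult_nonneg_nonneg) (auto simp: field_simps)

lemma gap_tendsto_0:
  assumes "q > 8 / 15"
  shows "(gap q \<longlongrightarrow> 0) (at_right 0)"
proof -
  have "((\<lambda>t::real. ln (sinh t / t)) \<longlongrightarrow> 0) (at_right 0)"
    unfolding sinh_field_def by real_asymp
  moreover have "((\<lambda>t. 5 / (15 * q - 8) * ln (8 / (15 * q) + (1 - 8 / (15 * q)) * cosh t powr q))
      \<longlongrightarrow> 5 / (15 * q - 8) * ln (8 / (15 * q) + (1 - 8 / (15 * q)) * cosh 0 powr q)) (at_right 0)"
    by (intro tendsto_intros) auto
  ultimately show ?thesis
    unfolding gap_def using tendsto_diff by fastforce
qed

lemma gap_has_derivative:
  assumes q: "q > 8 / 15" and t: "t > 0"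
  shows "(gap q has_real_derivative
    (weight q t - threshold t) * (t * cosh t - sinh t) / (t * sinh t * weight q t)) (at t)"
proof -
  let ?w = "8 / (15 * q)"
  let ?A = "?w + (1 - ?w) * cosh t powr q"
  have A: "?A = cosh t powr q * weight q t"
  proof -
    have "w + (1 - w) * y = y * (1 - w * (1 - inverse y))" if "y > 0" for w y :: real
      using that by (simp add: field_simps)
    then show ?thesis
      by (simp add: weight_def powr_minus)
  qed
  have pos: "sinh t > 0" "cosh t > 0" "cosh t powr q > 0" "weight q t > 0" "t * cosh t - sinh t > 0"
    using t q sinh_less_times_cosh[OF t] by (auto simp: weight_pos)
  have "((\<lambda>t. ln (sinh t / t)) has_real_derivative (t * cosh t - sinh t) / (t * sinh t)) (at t)"
    using pos t by (auto intro!: derivative_eq_intros simp: field_simps)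
  moreover have "((\<lambda>t. ?w + (1 - ?w) * cosh t powr q) has_real_derivative
      (1 - ?w) * (q * cosh t powr q * sinh t / cosh t)) (at t)"
    using pos powr_diff[of "cosh t" q 1] by (auto intro!: derivative_eq_intros)
  ultimately have "(gap q has_real_derivative (t * cosh t - sinh t) / (t * sinh t)
      - 5 / (15 * q - 8) * (1 / ?A * ((1 - ?w) * (q * cosh t powr q * sinh t / cosh t)))) (at t)"
    unfolding gap_def
    by (intro DERIV_diff DERIV_cmult DERIV_chain2[OF DERIV_ln_divide] weighted_mean_pos[OF q])
  also have "5 / (15 * q - 8) * (1 / ?A * ((1 - ?w) * (q * cosh t powr q * sinh t / cosh t)))
      = (5 / (15 * q - 8) * ((1 - ?w) * q)) * (sinh t / (cosh t * weight q t))"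
    unfolding A using pos by (simp add: mult_ac)
  \<comment> \<open>Since (1 - \<open>?w\<close>) q = (15q - 8)/15, the parameter cancels. This is
    the source of the factor 3 in \<open>threshold\<close>.\<close>
  also have "5 / (15 * q - 8) * ((1 - ?w) * q) = 1 / 3"
    using q by (simp add: field_simps)
  also have "(t * cosh t - sinh t) / (t * sinh t) - 1 / 3 * (sinh t / (cosh t * weight q t))
      = (weight q t - threshold t) * (t * cosh t - sinh t) / (t * sinh t * weight q t)"
    unfolding threshold_def using pos t by (simp add: divide_simps power2_eq_square)
  finally show ?thesis .
qed

lemma gap_pos:
  assumes "q > 8 / 15" "t > 0" and "\<And>s. 0 < s \<Longrightarrow> s \<le> t \<Longrightarrow> threshold s < weight q s"
  shows "gap q t > 0"
proof (rule greater_limit_if_deriv_pos[OF gap_tendsto_0[OF assms(1)] _ assms(2)])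
  fix s :: real assume "0 < s" "s \<le> t"
  let ?d = "(weight q s - threshold s) * (s * cosh s - sinh s) / (s * sinh s * weight q s)"
  have "?d > 0"
    using sinh_less_times_cosh[of s] weight_pos[OF assms(1), of s] assms(3)[of s]
      \<open>0 < s\<close> \<open>s \<le> t\<close> by simp
  then show "\<exists>d > 0. (gap q has_real_derivative d) (at s)"
    using gap_has_derivative[OF assms(1) \<open>0 < s\<close>] by blast
qed

text \<open>The comparison is demanded only up to \<open>t\<close>, so that it can be applied where
  the sign is known merely near 0.\<close>

lemma gap_neg:
  assumes "q > 8 / 15" "t > 0" and "\<And>s. 0 < s \<Longrightarrow> s \<le> t \<Longrightarrow> weight q s < threshold s"
  shows "gap q t < 0"
proof (rule less_limit_if_deriv_neg[OF gap_tendsto_0[OF assms(1)] _ assms(2)])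
  fix s :: real assume "0 < s" "s \<le> t"
  let ?d = "(weight q s - threshold s) * (s * cosh s - sinh s) / (s * sinh s * weight q s)"
  have "?d < 0"
    using sinh_less_times_cosh[of s] weight_pos[OF assms(1), of s] assms(3)[of s]
      \<open>0 < s\<close> \<open>s \<le> t\<close> by (simp add: divide_neg_pos mult_neg_pos)
  then show "\<exists>d < 0. (gap q has_real_derivative d) (at s)"
    using gap_has_derivative[OF assms(1) \<open>0 < s\<close>] by blast
qed

section \<open>Exact parameter ranges for the sign of the gap\<close>

lemma gap_pos_iff:
  assumes "q > 8 / 15"
  shows "(\<forall>t > 0. gap q t > 0) \<longleftrightarrow> q \<ge> 34 / 35"
proof
  assume "q \<ge> 34 / 35"
  have "threshold s < weight q s" if "s > 0" for s
    using threshold_less_weight[OF that] weight_mono[of "34/35" q s] \<open>q \<ge> 34 / 35\<close> by linarith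
  then show "\<forall>t > 0. gap q t > 0"
    by (intro allI impI gap_pos[OF assms])
next
  assume pos: "\<forall>t > 0. gap q t > 0"
  show "q \<ge> 34 / 35"
  proof (rule ccontr)
    assume "\<not> q \<ge> 34 / 35"
    \<comment> \<open>For q < 34/35 the leading coefficient (q - 34/35)/15 is negative, so the gap
      decreases from its limit 0 and is negative for small t.\<close>
    then have "eventually (\<lambda>t. (weight q t - threshold t) / t ^ 4 < 0) (at_right 0)"
      using assms by (intro order_tendstoD(2)[OF weight_minus_threshold_asymp]) auto
    then obtain b where "b > 0" and b: "\<And>t. 0 < t \<Longrightarrow> t < b \<Longrightarrow> (weight q t - threshold t) / t ^ 4 < 0"
      unfolding eventually_at_right_field by auto
    have "gap q (b / 2) < 0"
    proof (rule gap_neg[OF assms])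
      fix s assume "0 < s" "s \<le> b / 2"
      then show "weight q s < threshold s"
        using b[of s] by (simp add: divide_less_0_iff)
    qed (use \<open>b > 0\<close> in simp)
    then show False
      using pos \<open>b > 0\<close> by (meson half_gt_zero not_less_iff_gr_or_eq)
  qed
qed

lemma gap_neg_iff:
  assumes "q > 8 / 15"
  shows "(\<forall>t > 0. gap q t < 0) \<longleftrightarrow> q \<le> 4 / 5"
proof
  assume "q \<le> 4 / 5"
  have "weight q s < threshold s" if "s > 0" for s
    using weight_less_threshold[OF that] weight_mono[of q "4/5" s] \<open>q \<le> 4 / 5\<close> assms by linarith
  then show "\<forall>t > 0. gap q t < 0"
    by (intro allI impI gap_neg[OF assms])
next
  assume neg: "\<forall>t > 0. gap q t < 0"
  show "q \<le> 4 / 5"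
  proof (rule ccontr)
    assume "\<not> q \<le> 4 / 5"
    \<comment> \<open>\<open>k\<close> bounds the linear growth rate of the subtracted logarithm in
      \<open>gap\<close>, while ln(sinh t / t) grows at rate 1. Given q > 8/15, k < 1 holds exactly
      when q > 4/5.\<close>
    define k where "k = 5 / (15 * q - 8) * q"
    have "k < 1"
      using assms \<open>\<not> q \<le> 4 / 5\<close> by (simp add: k_def divide_simps)
    have lower: "ln (sinh t / t) - k * t \<le> gap q t" if "t > 0" for t
    proof -
      \<comment> \<open>As cosh t is at least 1, the weighted mean of 1 and
        \<open>cosh t powr q\<close> is at most the latter, which is at most exp(qt).\<close>
      have "8 / (15 * q) + (1 - 8 / (15 * q)) * cosh t powr q \<le>
          8 / (15 * q) * cosh t powr q + (1 - 8 / (15 * q)) * cosh t powr q"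
        using assms ge_one_powr_ge_zero[OF cosh_real_ge_1[of t], of q]
        by (intro add_right_mono) (simp add: divide_right_mono)
      also have "\<dots> = cosh t powr q"
        by (simp add: algebra_simps)
      also have "\<dots> \<le> exp t powr q"
        using assms that by (intro powr_mono2) (auto simp: cosh_field_def)
      finally have "ln (8 / (15 * q) + (1 - 8 / (15 * q)) * cosh t powr q) \<le> ln (exp t powr q)"
        using weighted_mean_pos[OF assms, of t] by (subst ln_le_cancel_iff) auto
      then have "5 / (15 * q - 8) * ln (8 / (15 * q) + (1 - 8 / (15 * q)) * cosh t powr q)
          \<le> 5 / (15 * q - 8) * (q * t)"
        using assms by (intro mult_left_mono) auto
      then show ?thesis by (simp add: gap_def k_def)
    qed
    have "filterlim (\<lambda>t::real. ln (sinh t / t) - k * t) at_top at_top"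
      using \<open>k < 1\<close> unfolding sinh_field_def by real_asymp
    then have "eventually (\<lambda>t. ln (sinh t / t) - k * t > 0 \<and> t > 0) at_top"
      by (intro eventually_conj eventually_gt_at_top) (metis filterlim_at_top_dense)
    then obtain t where "ln (sinh t / t) - k * t > 0" "t > 0"
      using eventually_happens by force
    then show False
      using lower[of t] neg by fastforce
  qed
qed

section \<open>Return from the variable t to the means\<close>

lemma SB_cosh:
  assumes "a > 0" "t > 0"
  shows "SB (a * cosh t) a = a * exp (ln (sinh t / t))"
proof -
  have "(a * cosh t)\<^sup>2 - a\<^sup>2 = (a * sinh t)\<^sup>2"
    by (simp add: cosh_square_eq power_mult_distrib algebra_simps)
  then show ?thesis
    using assms by (simp add: SB_def arcosh_cosh_real)
qed

lemma bound_cosh: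
  fixes a q t :: real
  assumes q: "q > 8 / 15" and a: "a > 0"
  shows "(8 / (15 * q) * a powr q + (1 - 8 / (15 * q)) * (a * cosh t) powr q) powr (5 / (15 * q - 8))
      * a powr ((10 * q - 8) / (15 * q - 8))
    = a * exp (5 / (15 * q - 8) * ln (8 / (15 * q) + (1 - 8 / (15 * q)) * cosh t powr q))"
proof -
  let ?w = "8 / (15 * q)" and ?e = "5 / (15 * q - 8)"
  let ?A = "?w + (1 - ?w) * cosh t powr q"
  have "?w * a powr q + (1 - ?w) * (a * cosh t) powr q = a powr q * ?A"
    using a by (simp add: powr_mult algebra_simps)
  then have "(?w * a powr q + (1 - ?w) * (a * cosh t) powr q) powr ?e = a powr (q * ?e) * ?A powr ?e"
    using weighted_mean_pos[OF q, of t] by (simp add: powr_mult powr_powr)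
  moreover have "a powr (q * ?e) * a powr ((10 * q - 8) / (15 * q - 8)) = a"
  proof -
    \<comment> \<open>The exponents of a add up to 1: the bound is homogeneous of degree
      one.\<close>
    have "q * ?e + (10 * q - 8) / (15 * q - 8) = 1"
      using q by (simp add: divide_simps)
    then show ?thesis
      using a by (simp flip: powr_add)
  qed
  moreover have "?A powr ?e = exp (?e * ln ?A)"
    using weighted_mean_pos[OF q, of t] by (simp add: powr_def)
  ultimately show ?thesis by (simp add: mult_ac)
qed

text \<open>For fixed a > 0, the map from t to a cosh t sends the positive reals onto the b > a; a
  preimage of b is arcosh(b/a).\<close>

lemma all_gt_iff_all_cosh:
  fixes P :: "real \<Rightarrow> real \<Rightarrow> bool"
  shows "(\<forall>a b. b > a \<and> a > 0 \<longrightarrow> P a b) \<longleftrightarrow> (\<forall>a > 0. \<forall>t > 0. P a (a * cosh t))"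
proof safe
  fix a t :: real
  assume "\<forall>a b. b > a \<and> a > 0 \<longrightarrow> P a b" "a > 0" "t > 0"
  moreover have "cosh t > 1"
    using cosh_real_strict_mono[of 0 t] \<open>t > 0\<close> by simp
  ultimately show "P a (a * cosh t)" by simp
next
  fix a b :: real
  assume P: "\<forall>a > 0. \<forall>t > 0. P a (a * cosh t)" and "a < b" "0 < a"
  then have "b / a > 1" by simp
  then have "arcosh (b / a) > 0" "a * cosh (arcosh (b / a)) = b"
    using \<open>0 < a\<close> by simp_all
  then show "P a b" using P \<open>0 < a\<close> by metis
qed

theorem theorem9:
  fixes q :: real
  assumes "q > 8 / 15"
  shows "((\<forall>a b :: real. b > a \<and> a > 0 \<longrightarrow>
            SB b a > ((8 / (15 * q)) * a powr q + (1 - 8 / (15 * q)) * b powr q) powr (5 / (15 * q - 8))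
                       * a powr ((10 * q - 8) / (15 * q - 8)))
          \<longleftrightarrow> q \<ge> 34 / 35)
       \<and> ((\<forall>a b :: real. b > a \<and> a > 0 \<longrightarrow>
            SB b a < ((8 / (15 * q)) * a powr q + (1 - 8 / (15 * q)) * b powr q) powr (5 / (15 * q - 8))
                       * a powr ((10 * q - 8) / (15 * q - 8)))
          \<longleftrightarrow> q \<le> 4 / 5)"
proof -
  have
    "(SB (a * cosh t) a >
        (8 / (15 * q) * a powr q + (1 - 8 / (15 * q)) * (a * cosh t) powr q) powr (5 / (15 * q - 8))
          * a powr ((10 * q - 8) / (15 * q - 8))) \<longleftrightarrow> gap q t > 0"
    "(SB (a * cosh t) a <
        (8 / (15 * q) * a powr q + (1 - 8 / (15 * q)) * (a * cosh t) powr q) powr (5 / (15 * q - 8))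
          * a powr ((10 * q - 8) / (15 * q - 8))) \<longleftrightarrow> gap q t < 0"
    if "a > 0" "t > 0" for a t
    \<comment> \<open>Both sides are a times an exponential, and the exponents differ by
      \<open>gap q t\<close>.\<close>
    unfolding SB_cosh[OF that] bound_cosh[OF assms that(1)] mult_less_cancel_left_pos[OF that(1)]
      exp_less_cancel_iff gap_def by auto
  then show ?thesis
    unfolding all_gt_iff_all_cosh gap_pos_iff[OF assms, symmetric] gap_neg_iff[OF assms, symmetric]
    \<comment> \<open>The sign of the gap does not involve a; the instance a = 1 removes the
      quantifier over a.\<close>
    by (metis zero_less_one)
qed

end
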